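(* Let $m,n\ge 1$ be integers, and let $u=(u_1,\ldots,u_n)$, $u'=(u_1',\ldots,u_n')$, $v=(v_1,\ldots,v_m)$, $v'=(v_1',\ldots,v_m')$ be vectors all of whose entries are $+1$ or $-1$. Then a $(u,u'|v,v')$-ASM exists if and only if all three of the following conditions hold: (i) $r^-_m-r^+_m=c^-_n-c^+_n$; (ii) $-u^+\le r^-_k-r^+_k\le u^-$ for all $k=1,2,\ldots,m$; (iii) $-v^+\le c^-_l-c^+_l\le v^-$ for all $l=1,2,\ldots,n$.
   Context: A $(u,u'|v,v')$-ASM is an $m\times n$ matrix $A=[a_{ij}]$ with entries in $\{0,+1,-1\}$ such that: for each $i=1,\ldots,m$, the nonzero terms of the sequence $v_i,a_{i1},a_{i2},\ldots,a_{in},v_i'$ alternate in sign (ignoring zeros, consecutive nonzero terms have opposite signs); and for each $j=1,\ldots,n$, the nonzero terms of the sequence $u_j,a_{1j},a_{2j},\ldots,a_{mj},u_j'$ alternate in sign. (That is, $A$ is bordered by $u$ on top, $u'$ on the bottom, $v$ on the left and $v'$ on the right.) Notation: for $1\le k\le m$, $r^+_k=|\{i\le k: v_i=v_i'=+1\}|$ and $r^-_k=|\{i\le k: v_i=v_i'=-1\}|$; for $1\le l\le n$, $c^+_l=|\{j\le l: u_j=u_j'=+1\}|$ and $c^-_l=|\{j\le l: u_j=u_j'=-1\}|$. Also $u^+=|\{j: u_j=+1\}|$, $u^-=|\{j: u_j=-1\}|$, $v^+=|\{i: v_i=+1\}|$, $v^-=|\{i: v_i=-1\}|$ (these depend only on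 $u$ and $v$, not on $u'$, $v'$). *)

theory Defs
  imports Main
begin

text \<open>
  Vectors of length \<open>n\<close> and \<open>m \<times> n\<close> matrices are functions on \<open>nat\<close>, indexed from 1; only the
  values at indices in \<open>{1..n}\<close>, respectively \<open>{1..m} \<times> {1..n}\<close>, are relevant.
\<close>

definition alternating :: "int list \<Rightarrow> bool" where
  "alternating xs \<longleftrightarrow> successively (\<lambda>x y. sgn x = - sgn y) (filter (\<lambda>x. x \<noteq> 0) xs)"

definition is_ASM ::
  "nat \<Rightarrow> nat \<Rightarrow> (nat \<Rightarrow> int) \<Rightarrow> (nat \<Rightarrow> int) \<Rightarrow> (nat \<Rightarrow> int) \<Rightarrow> (nat \<Rightarrow> int)
    \<Rightarrow> (nat \<Rightarrow> nat \<Rightarrow> int) \<Rightarrow> bool" where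
  "is_ASM m n u u' v v' A \<longleftrightarrow>
     (\<forall>i\<in>{1..m}. \<forall>j\<in>{1..n}. A i j \<in> {0, 1, -1}) \<and>
     (\<forall>i\<in>{1..m}. alternating (v i # map (\<lambda>j. A i j) [1..<Suc n] @ [v' i])) \<and>
     (\<forall>j\<in>{1..n}. alternating (u j # map (\<lambda>i. A i j) [1..<Suc m] @ [u' j]))"

text \<open>
  For \<open>s = \<plusminus>1\<close>, \<open>border_count s v v' k\<close> is $r^\pm_k$ and \<open>border_count s u u' l\<close> is $c^\pm_l$;
  \<open>sign_count s u n\<close> is $u^\pm$ and \<open>sign_count s v m\<close> is $v^\pm$. The counts are valued in \<open>int\<close>
  so that their differences are not truncated.
\<close>

definition border_count :: "int \<Rightarrow> (nat \<Rightarrow> int) \<Rightarrow> (nat \<Rightarrow> int) \<Rightarrow> nat \<Rightarrow> int" where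
  "border_count s x x' k = int (card {i \<in> {1..k}. x i = s \<and> x' i = s})"

definition sign_count :: "int \<Rightarrow> (nat \<Rightarrow> int) \<Rightarrow> nat \<Rightarrow> int" where
  "sign_count s x n = int (card {i \<in> {1..n}. x i = s})"

end

theory Submission
  imports Defs
begin

text \<open>
  A sequence of entries in $\{0,\pm 1\}$ bordered by $x, x' = \pm 1$ alternates exactly when all
  its partial sums lie in $\{0,-x\}$ and its total is $-(x+x')/2$
  (\<open>alternating_bordered_iff\<close>). In particular the sum of row \<open>i\<close> is determined by the
  border: it is $-1$, $+1$ or $0$, and the first \<open>k\<close> rows have total sum $r^-_k - r^+_k$;
  similarly for columns. This gives necessity: (i) counts the sum of all entries in two ways, and
  (ii) holds because each column contributes $0$ or $-u_j$ to the sum of the first \<open>k\<close> rows;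
  (iii) is (ii) for the transpose.

  For sufficiency, a matrix is described by its corner sums $H(i,j)$, the sums over the first
  \<open>i\<close> rows and \<open>j\<close> columns. It is an ASM with the given borders exactly when a vertical step of
  $H$ into row \<open>i\<close> is $0$ or $-v_i$, a horizontal step into column \<open>j\<close> is $0$ or $-u_j$,
  and $H$ has prescribed values on the four sides of the rectangle: $0$ on the top and on the left,
  $r^-_i - r^+_i$ on the right, $c^-_j - c^+_j$ at the bottom. Each side, together
  with the step conditions, forces a lower bound on $H(i,j)$. The maximum of these four
  bounds (\<open>least_corner_sum\<close>) satisfies the step conditions, since they are preserved by maxima,
  and conditions (i)--(iii) say precisely that no side forces more than the prescribed value on
  another side.
\<close>

section \<open>Alternation and partial sums\<close>

lemma alternating_Cons_zero [simp]: "alternating (v # 0 # xs) = alternating (v # xs)"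
  by (simp add: alternating_def)

lemma alternating_Cons_nonzero:
  assumes "v \<in> {1, -1}" and "x \<in> {1, -1}"
  shows "alternating (v # x # xs) \<longleftrightarrow> x = - v \<and> alternating (x # xs)"
  using assms by (auto simp: alternating_def)

lemma all_le_Suc_iff: "(\<forall>k\<le>Suc n. P k) \<longleftrightarrow> P 0 \<and> (\<forall>k\<le>n. P (Suc k))"
  by (metis Suc_le_mono le0 not0_implies_Suc)

text \<open>
  The running sum, started at the border entry \<open>v\<close>, has to oscillate between \<open>v\<close> and \<open>0\<close>. In the
  induction, a nonzero entry \<open>- v\<close> takes over the role of the border entry.
\<close>

lemma alternating_Cons_iff_partial_sums:
  assumes "v \<in> {1, -1}" and "set xs \<subseteq> {0, 1, -1}"
  shows "alternating (v # xs) \<longleftrightarrow> (\<forall>k\<le>length xs. sum_list (take k xs) \<in> {0, - v})"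
  using assms
proof (induction xs arbitrary: v)
  case Nil
  then show ?case by (simp add: alternating_def)
next
  case (Cons x xs)
  have xs: "set xs \<subseteq> {0, 1, -1}" using Cons.prems by auto
  consider "x = 0" | "x = v" "x \<in> {1, -1}" | "x = - v" "x \<in> {1, -1}"
    using Cons.prems by auto
  then show ?case
  proof cases
    case 1
    then show ?thesis
      using Cons.IH[OF Cons.prems(1) xs] by (simp add: all_le_Suc_iff)
  next
    case 2
    have "\<not> alternating (v # x # xs)"
      using 2 Cons.prems(1) by (auto simp: alternating_Cons_nonzero)
    moreover have "sum_list (take 1 (x # xs)) \<notin> {0, - v}"
      using 2 by auto
    ultimately show ?thesis
      by (metis One_nat_def Suc_le_mono le0 length_Cons)
  next
    case 3
    have "(- v + s \<in> {0, - v}) \<longleftrightarrow> s \<in> {0, - x}" for s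
      using 3 by auto
    moreover have "alternating (v # x # xs) \<longleftrightarrow> alternating (x # xs)"
      using 3 Cons.prems(1) alternating_Cons_nonzero by blast
    ultimately show ?thesis
      using Cons.IH[OF 3(2) xs] 3(1) by (simp add: all_le_Suc_iff)
  qed
qed

lemma sum_list_map_upt: "sum_list (map f [1..<Suc k]) = (\<Sum>j=1..k. f j :: int)"
  by (metis atLeastLessThanSuc_atLeastAtMost interv_sum_list_conv_sum_set_nat set_upt)

lemma alternating_bordered_iff:
  assumes v: "v \<in> {1, -1}" and w: "w \<in> {1, -1}" and f: "\<forall>j\<in>{1..n}. f j \<in> {0, 1, -1}"
  shows "alternating (v # map f [1..<Suc n] @ [w]) \<longleftrightarrow>
    (\<forall>k\<le>n. (\<Sum>j=1..k. f j) \<in> {0, - v}) \<and> 2 * (\<Sum>j=1..n. f j) = - (v + w)"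
proof -
  let ?xs = "map f [1..<Suc n] @ [w]"
  let ?s = "\<lambda>k. \<Sum>j=1..k. f j"
  have "set ?xs \<subseteq> {0, 1, -1}" using f w by auto
  then have "alternating (v # ?xs) \<longleftrightarrow> (\<forall>k\<le>Suc n. sum_list (take k ?xs) \<in> {0, - v})"
    using alternating_Cons_iff_partial_sums[OF v, of ?xs] by (simp del: upt_Suc)
  also have "\<dots> \<longleftrightarrow> (\<forall>k\<le>n. sum_list (take k ?xs) \<in> {0, - v}) \<and> sum_list ?xs \<in> {0, - v}"
    by (auto simp: le_Suc_eq)
  also have "(\<forall>k\<le>n. sum_list (take k ?xs) \<in> {0, - v}) \<longleftrightarrow> (\<forall>k\<le>n. ?s k \<in> {0, - v})"
  proof -
    have "sum_list (take k ?xs) = ?s k" if "k \<le> n" for k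
      using that sum_list_map_upt[of f k] by (simp add: take_map del: upt_Suc)
    then show ?thesis by simp
  qed
  also have "sum_list ?xs = ?s n + w"
    using sum_list_map_upt[of f n] by (simp del: upt_Suc)
  also have "(\<forall>k\<le>n. ?s k \<in> {0, - v}) \<and> ?s n + w \<in> {0, - v} \<longleftrightarrow>
      (\<forall>k\<le>n. ?s k \<in> {0, - v}) \<and> 2 * ?s n = - (v + w)"
  proof (rule conj_cong[OF refl])
    assume "\<forall>k\<le>n. ?s k \<in> {0, - v}"
    then have "?s n \<in> {0, - v}" by blast
    then show "?s n + w \<in> {0, - v} \<longleftrightarrow> 2 * ?s n = - (v + w)"
      using v w by auto
  qed
  finally show ?thesis .
qed

lemma is_ASM_iff_partial_sums:
  assumes "\<forall>j\<in>{1..n}. u j \<in> {1, -1}" and "\<forall>j\<in>{1..n}. u' j \<in> {1, -1}"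
    and "\<forall>i\<in>{1..m}. v i \<in> {1, -1}" and "\<forall>i\<in>{1..m}. v' i \<in> {1, -1}"
  shows "is_ASM m n u u' v v' A \<longleftrightarrow>
    (\<forall>i\<in>{1..m}. \<forall>j\<in>{1..n}. A i j \<in> {0, 1, -1}) \<and>
    (\<forall>i\<in>{1..m}. (\<forall>l\<le>n. (\<Sum>j=1..l. A i j) \<in> {0, - v i}) \<and>
      2 * (\<Sum>j=1..n. A i j) = - (v i + v' i)) \<and>
    (\<forall>j\<in>{1..n}. (\<forall>k\<le>m. (\<Sum>i=1..k. A i j) \<in> {0, - u j}) \<and>
      2 * (\<Sum>i=1..m. A i j) = - (u j + u' j))"
  unfolding is_ASM_def
proof (intro conj_cong refl ball_cong)
  fix i assume "\<forall>i\<in>{1..m}. \<forall>j\<in>{1..n}. A i j \<in> {0, 1, -1}" and "i \<in> {1..m}"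
  then show "alternating (v i # map (\<lambda>j. A i j) [1..<Suc n] @ [v' i]) \<longleftrightarrow>
      (\<forall>l\<le>n. (\<Sum>j=1..l. A i j) \<in> {0, - v i}) \<and> 2 * (\<Sum>j=1..n. A i j) = - (v i + v' i)"
    using assms by (intro alternating_bordered_iff) auto
next
  fix j assume "\<forall>i\<in>{1..m}. \<forall>j\<in>{1..n}. A i j \<in> {0, 1, -1}" and "j \<in> {1..n}"
  then show "alternating (u j # map (\<lambda>i. A i j) [1..<Suc m] @ [u' j]) \<longleftrightarrow>
      (\<forall>k\<le>m. (\<Sum>i=1..k. A i j) \<in> {0, - u j}) \<and> 2 * (\<Sum>i=1..m. A i j) = - (u j + u' j)"
    using assms by (intro alternating_bordered_iff) auto
qed

section \<open>Border counts\<close>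

text \<open>
  For the borders $v, v'$ this is $r^-_k - r^+_k$, the sum of the first \<open>k\<close> rows of
  any ASM with these borders; for $u, u'$ it is $c^-_k - c^+_k$.
\<close>

definition border_sum :: "(nat \<Rightarrow> int) \<Rightarrow> (nat \<Rightarrow> int) \<Rightarrow> nat \<Rightarrow> int" where
  "border_sum x x' k = border_count (-1) x x' k - border_count 1 x x' k"

lemma card_Collect_Icc_Suc:
  "card {i \<in> {1..Suc k}. P i} = card {i \<in> {1..k}. P i} + (if P (Suc k) then 1 else 0)"
proof -
  have "{i \<in> {1..Suc k}. P i} = {i \<in> {1..k}. P i} \<union> (if P (Suc k) then {Suc k} else {})"
    by (auto simp: le_Suc_eq)
  then show ?thesis by (simp add: card_insert_if)
qed

lemma sign_count_0 [simp]: "sign_count s x 0 = 0"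
  by (simp add: sign_count_def)

lemma sign_count_Suc [simp]:
  "sign_count s x (Suc k) = sign_count s x k + (if x (Suc k) = s then 1 else 0)"
  unfolding sign_count_def card_Collect_Icc_Suc by simp

lemma sign_count_nonneg: "0 \<le> sign_count s x k"
  by (simp add: sign_count_def)

lemma sign_count_mono: "j \<le> k \<Longrightarrow> sign_count s x j \<le> sign_count s x k"
  by (induction rule: dec_induct) auto

lemma border_sum_0 [simp]: "border_sum x x' 0 = 0"
  by (simp add: border_sum_def border_count_def)

lemma border_sum_Suc [simp]:
  "border_sum x x' (Suc k) = border_sum x x' k +
    (if x (Suc k) = -1 \<and> x' (Suc k) = -1 then 1
     else if x (Suc k) = 1 \<and> x' (Suc k) = 1 then -1 else 0)"
  unfolding border_sum_def border_count_def card_Collect_Icc_Suc by auto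

lemma border_sum_diff_bounds:
  assumes "j \<le> k"
  shows "sign_count 1 x j - sign_count 1 x k \<le> border_sum x x' k - border_sum x x' j"
    and "border_sum x x' k - border_sum x x' j \<le> sign_count (-1) x k - sign_count (-1) x j"
  using assms by (induction rule: dec_induct) auto

lemma border_sum_eq_sum:
  assumes "\<forall>i\<in>{1..m}. x i \<in> {1, -1}" and "\<forall>i\<in>{1..m}. x' i \<in> {1, -1}"
    and "\<forall>i\<in>{1..m}. 2 * g i = - (x i + x' i)" and "k \<le> m"
  shows "border_sum x x' k = (\<Sum>i=1..k. g i)"
  using \<open>k \<le> m\<close>
proof (induction k)
  case 0
  then show ?case by simp
next
  case (Suc k)
  then have "Suc k \<in> {1..m}" by simp
  then have "x (Suc k) \<in> {1, -1}" "x' (Suc k) \<in> {1, -1}"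
      "2 * g (Suc k) = - (x (Suc k) + x' (Suc k))"
    using assms by blast+
  then show ?case using Suc by auto
qed

lemma sum_bounds_sign_count:
  assumes "\<forall>j\<in>{1..n}. x j \<in> {1, -1}" and "\<forall>j\<in>{1..n}. g j \<in> {0, - x j}"
  shows "- sign_count 1 x n \<le> (\<Sum>j=1..n. g j) \<and> (\<Sum>j=1..n. g j) \<le> sign_count (-1) x n"
  using assms
proof (induction n)
  case 0
  then show ?case by simp
next
  case (Suc n)
  then have "x (Suc n) \<in> {1, -1}" "g (Suc n) \<in> {0, - x (Suc n)}" by auto
  then have "g (Suc n) = 0 \<or> x (Suc n) = 1 \<and> g (Suc n) = -1 \<or> x (Suc n) = -1 \<and> g (Suc n) = 1"
    by auto
  with Suc show ?case by auto
qed

section \<open>Necessity\<close>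

lemma is_ASM_transpose:
  "is_ASM m n u u' v v' A \<Longrightarrow> is_ASM n m v v' u u' (\<lambda>i j. A j i)"
  by (auto simp: is_ASM_def)

lemma is_ASM_border_sum:
  assumes "\<forall>j\<in>{1..n}. u j \<in> {1, -1}" and "\<forall>j\<in>{1..n}. u' j \<in> {1, -1}"
    and "\<forall>i\<in>{1..m}. v i \<in> {1, -1}" and "\<forall>i\<in>{1..m}. v' i \<in> {1, -1}"
    and "is_ASM m n u u' v v' A" and "k \<le> m"
  shows "border_sum v v' k = (\<Sum>i=1..k. \<Sum>j=1..n. A i j)"
  using assms(5) unfolding is_ASM_iff_partial_sums[OF assms(1-4)]
  by (intro border_sum_eq_sum[OF assms(3,4) _ \<open>k \<le> m\<close>]) blast

text \<open>
  Summed by columns instead, the first \<open>k\<close> rows contribute \<open>0\<close> or \<open>- u j\<close> for each column \<open>j\<close>.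
\<close>

lemma is_ASM_border_sum_bounds:
  assumes "\<forall>j\<in>{1..n}. u j \<in> {1, -1}" and "\<forall>j\<in>{1..n}. u' j \<in> {1, -1}"
    and "\<forall>i\<in>{1..m}. v i \<in> {1, -1}" and "\<forall>i\<in>{1..m}. v' i \<in> {1, -1}"
    and "is_ASM m n u u' v v' A" and "k \<le> m"
  shows "- sign_count 1 u n \<le> border_sum v v' k \<and> border_sum v v' k \<le> sign_count (-1) u n"
proof -
  have "\<forall>j\<in>{1..n}. (\<Sum>i=1..k. A i j) \<in> {0, - u j}"
    using assms(5,6) unfolding is_ASM_iff_partial_sums[OF assms(1-4)] by blast
  from sum_bounds_sign_count[OF assms(1) this] show ?thesis
    unfolding is_ASM_border_sum[OF assms] by (subst (1 2) sum.swap)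
qed

section \<open>Sufficiency\<close>

text \<open>
  The mixed second difference recovers a matrix from its corner sums.
\<close>

definition corner_difference :: "(nat \<Rightarrow> nat \<Rightarrow> int) \<Rightarrow> nat \<Rightarrow> nat \<Rightarrow> int" where
  "corner_difference H i j = H i j - H (i - 1) j - H i (j - 1) + H (i - 1) (j - 1)"

lemma sum_corner_difference_row:
  "(\<Sum>j=1..l. corner_difference H i j) = H i l - H (i - 1) l - (H i 0 - H (i - 1) 0)"
  by (induction l) (auto simp: corner_difference_def)

lemma sum_corner_difference_column:
  "(\<Sum>i=1..k. corner_difference H i j) = H k j - H k (j - 1) - (H 0 j - H 0 (j - 1))"
  by (induction k) (auto simp: corner_difference_def)

lemma is_ASM_corner_difference:
  assumes u: "\<forall>j\<in>{1..n}. u j \<in> {1, -1}" and u': "\<forall>j\<in>{1..n}. u' j \<in> {1, -1}"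
    and v: "\<forall>i\<in>{1..m}. v i \<in> {1, -1}" and v': "\<forall>i\<in>{1..m}. v' i \<in> {1, -1}"
    and row_step: "\<And>i j. i < m \<Longrightarrow> j \<le> n \<Longrightarrow> H (Suc i) j - H i j \<in> {0, - v (Suc i)}"
    and column_step: "\<And>i j. i \<le> m \<Longrightarrow> j < n \<Longrightarrow> H i (Suc j) - H i j \<in> {0, - u (Suc j)}"
    and top: "\<And>j. j \<le> n \<Longrightarrow> H 0 j = 0"
    and left: "\<And>i. i \<le> m \<Longrightarrow> H i 0 = 0"
    and bottom: "\<And>j. j \<le> n \<Longrightarrow> H m j = border_sum u u' j"
    and right: "\<And>i. i \<le> m \<Longrightarrow> H i n = border_sum v v' i"
  shows "is_ASM m n u u' v v' (corner_difference H)"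
  unfolding is_ASM_iff_partial_sums[OF u u' v v']
proof (intro conjI ballI allI impI)
  fix i j assume i: "i \<in> {1..m}" and j: "j \<in> {1..n}"
  \<comment> \<open>An entry is the difference of two steps into row \<open>i\<close>, both in \<open>{0, - v i}\<close>.\<close>
  then obtain i' j' where "i = Suc i'" "j = Suc j'" "i' < m" "j' < n"
    by (cases i; cases j) auto
  moreover have "v i \<in> {1, -1}" using i v by blast
  ultimately show "corner_difference H i j \<in> {0, 1, -1}"
    using row_step[of i' "Suc j'"] row_step[of i' j'] by (auto simp: corner_difference_def)
next
  fix i l assume "i \<in> {1..m}" and "l \<le> n"
  then show "(\<Sum>j=1..l. corner_difference H i j) \<in> {0, - v i}"
    using row_step[of "i - 1" l] left unfolding sum_corner_difference_row by auto
next
  fix i assume i: "i \<in> {1..m}"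
  then obtain i' where "i = Suc i'" "i' < m" by (cases i) auto
  moreover have "v i \<in> {1, -1}" "v' i \<in> {1, -1}" using i v v' by blast+
  ultimately show "2 * (\<Sum>j=1..n. corner_difference H i j) = - (v i + v' i)"
    unfolding sum_corner_difference_row by (auto simp: left right)
next
  fix j k assume "j \<in> {1..n}" and "k \<le> m"
  then show "(\<Sum>i=1..k. corner_difference H i j) \<in> {0, - u j}"
    using column_step[of k "j - 1"] top unfolding sum_corner_difference_column by auto
next
  fix j assume j: "j \<in> {1..n}"
  then obtain j' where "j = Suc j'" "j' < n" by (cases j) auto
  moreover have "u j \<in> {1, -1}" "u' j \<in> {1, -1}" using j u u' by blast+
  ultimately show "2 * (\<Sum>i=1..m. corner_difference H i j) = - (u j + u' j)"
    unfolding sum_corner_difference_column by (auto simp: top bottom)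
qed

text \<open>
  The four terms are the lower bounds forced by the left, top, bottom and right side. From the left
  side, each of the first \<open>i\<close> rows contributes at least $-1$, and at least $0$ when
  $v_i = -1$. From the bottom side, the first \<open>j\<close> columns have total sum $c^-_j - c^+_j$,
  and each row below row \<open>i\<close> contributes at most $1$ to it, and at most $0$ when
  $v_i = +1$. The other two are the transposes of these.
\<close>

definition least_corner_sum ::
  "nat \<Rightarrow> nat \<Rightarrow> (nat \<Rightarrow> int) \<Rightarrow> (nat \<Rightarrow> int) \<Rightarrow> (nat \<Rightarrow> int) \<Rightarrow> (nat \<Rightarrow> int) \<Rightarrow> nat \<Rightarrow> nat \<Rightarrow> int" where
  "least_corner_sum m n u u' v v' i j =
    max (max (- sign_count 1 v i) (- sign_count 1 u j))
      (max (border_sum u u' j - (sign_count (-1) v m - sign_count (-1) v i))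
           (border_sum v v' i - (sign_count (-1) u n - sign_count (-1) u j)))"

lemma least_corner_sum_transpose:
  "least_corner_sum n m v v' u u' j i = least_corner_sum m n u u' v v' i j"
  by (simp add: least_corner_sum_def max.commute)

text \<open>
  Each of the four terms changes by \<open>0\<close> or \<open>- v (Suc i)\<close>, hence so does their maximum.
\<close>

lemma least_corner_sum_row_step:
  assumes "v (Suc i) \<in> {1, -1}"
  shows "least_corner_sum m n u u' v v' (Suc i) j - least_corner_sum m n u u' v v' i j
    \<in> {0, - v (Suc i)}"
  using assms by (auto simp: least_corner_sum_def max_def)

lemma least_corner_sum_top:
  assumes "j \<le> n" and "border_sum u u' j \<le> sign_count (-1) v m"
  shows "least_corner_sum m n u u' v v' 0 j = 0"
  using assms sign_count_nonneg[of 1 u j] sign_count_mono[OF \<open>j \<le> n\<close>, of "-1" u]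
  by (simp add: least_corner_sum_def max_def)

text \<open>
  The right side reaches the bottom side only through the corner, where condition (i) makes the
  prescribed values agree.
\<close>

lemma least_corner_sum_bottom:
  assumes "j \<le> n" and "- sign_count 1 v m \<le> border_sum u u' j"
    and "border_sum v v' m = border_sum u u' n"
  shows "least_corner_sum m n u u' v v' m j = border_sum u u' j"
  using assms border_sum_diff_bounds(1)[of 0 j u u'] border_sum_diff_bounds(2)[OF \<open>j \<le> n\<close>, of u u']
  by (simp add: least_corner_sum_def max_def)

lemma exists_ASM:
  assumes u: "\<forall>j\<in>{1..n}. u j \<in> {1, -1}" and u': "\<forall>j\<in>{1..n}. u' j \<in> {1, -1}"
    and v: "\<forall>i\<in>{1..m}. v i \<in> {1, -1}" and v': "\<forall>i\<in>{1..m}. v' i \<in> {1, -1}"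
    and corner: "border_sum v v' m = border_sum u u' n"
    and rows: "\<And>k. k \<le> m \<Longrightarrow>
      - sign_count 1 u n \<le> border_sum v v' k \<and> border_sum v v' k \<le> sign_count (-1) u n"
    and columns: "\<And>l. l \<le> n \<Longrightarrow>
      - sign_count 1 v m \<le> border_sum u u' l \<and> border_sum u u' l \<le> sign_count (-1) v m"
  shows "\<exists>A. is_ASM m n u u' v v' A"
proof
  let ?H = "least_corner_sum m n u u' v v'"
  note transpose = least_corner_sum_transpose[of m n u u' v v']
  show "is_ASM m n u u' v v' (corner_difference ?H)"
  proof (rule is_ASM_corner_difference[OF u u' v v'])
    show "?H (Suc i) j - ?H i j \<in> {0, - v (Suc i)}" if "i < m" for i j
      using that v by (intro least_corner_sum_row_step) auto
    show "?H i (Suc j) - ?H i j \<in> {0, - u (Suc j)}" if "j < n" for i j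
      unfolding transpose using that u by (intro least_corner_sum_row_step) auto
    show "?H 0 j = 0" if "j \<le> n" for j
      using that columns by (intro least_corner_sum_top) auto
    show "?H i 0 = 0" if "i \<le> m" for i
      unfolding transpose using that rows by (intro least_corner_sum_top) auto
    show "?H m j = border_sum u u' j" if "j \<le> n" for j
      using that columns corner by (intro least_corner_sum_bottom) auto
    show "?H i n = border_sum v v' i" if "i \<le> m" for i
      unfolding transpose using that rows corner by (intro least_corner_sum_bottom) auto
  qed
qed

section \<open>The existence criterion\<close>

theorem theorem2p1:
  fixes m n :: nat and u u' v v' :: "nat \<Rightarrow> int"
  assumes "m \<ge> 1" and "n \<ge> 1"
    and "\<forall>j\<in>{1..n}. u j \<in> {1, -1}" and "\<forall>j\<in>{1..n}. u' j \<in> {1, -1}"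
    and "\<forall>i\<in>{1..m}. v i \<in> {1, -1}" and "\<forall>i\<in>{1..m}. v' i \<in> {1, -1}"
  shows "(\<exists>A. is_ASM m n u u' v v' A) \<longleftrightarrow>
    border_count (-1) v v' m - border_count 1 v v' m
      = border_count (-1) u u' n - border_count 1 u u' n \<and>
    (\<forall>k\<in>{1..m}. - sign_count 1 u n \<le> border_count (-1) v v' k - border_count 1 v v' k \<and>
                 border_count (-1) v v' k - border_count 1 v v' k \<le> sign_count (-1) u n) \<and>
    (\<forall>l\<in>{1..n}. - sign_count 1 v m \<le> border_count (-1) u u' l - border_count 1 u u' l \<and>
                 border_count (-1) u u' l - border_count 1 u u' l \<le> sign_count (-1) v m)"
  unfolding border_sum_def[symmetric]
proof (intro iffI; (elim exE conjE)?)
  fix A assume A: "is_ASM m n u u' v v' A"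
  note A' = is_ASM_transpose[OF A]
  have "border_sum v v' m = border_sum u u' n"
    unfolding is_ASM_border_sum[OF assms(3-6) A order.refl]
      is_ASM_border_sum[OF assms(5,6,3,4) A' order.refl]
    by (rule sum.swap)
  then show "border_sum v v' m = border_sum u u' n \<and>
    (\<forall>k\<in>{1..m}. - sign_count 1 u n \<le> border_sum v v' k \<and>
                 border_sum v v' k \<le> sign_count (-1) u n) \<and>
    (\<forall>l\<in>{1..n}. - sign_count 1 v m \<le> border_sum u u' l \<and>
                 border_sum u u' l \<le> sign_count (-1) v m)"
    using is_ASM_border_sum_bounds[OF assms(3-6) A]
      is_ASM_border_sum_bounds[OF assms(5,6,3,4) A'] by auto
next
  assume corner: "border_sum v v' m = border_sum u u' n"
    and rows: "\<forall>k\<in>{1..m}. - sign_count 1 u n \<le> border_sum v v' k \<and>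
                 border_sum v v' k \<le> sign_count (-1) u n"
    and columns: "\<forall>l\<in>{1..n}. - sign_count 1 v m \<le> border_sum u u' l \<and>
                 border_sum u u' l \<le> sign_count (-1) v m"
  show "\<exists>A. is_ASM m n u u' v v' A"
  proof (rule exists_ASM[OF assms(3-6) corner])
    show "- sign_count 1 u n \<le> border_sum v v' k \<and> border_sum v v' k \<le> sign_count (-1) u n"
      if "k \<le> m" for k
      using that rows by (cases k) (auto simp: sign_count_nonneg simp del: border_sum_Suc)
    show "- sign_count 1 v m \<le> border_sum u u' l \<and> border_sum u u' l \<le> sign_count (-1) v m"
      if "l \<le> n" for l
      using that columns by (cases l) (auto simp: sign_count_nonneg simp del: border_sum_Suc)
  qed
qed

end
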